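(* For any integer $k\neq 0$, let $VT(2,k)$ be the oriented virtual knot or link represented by the closure of the virtual 2-braid $(\sigma_1)^k v_1$, with all strands oriented downward, where $\sigma_1$ and $v_1$ denote the standard (classical) braid generator and the virtual braid generator, respectively. Then $VT(2,k)$ is not checkerboard colorable.
   Context: From a virtual link diagram build a surface with boundary $F$ having a disk ($0$-handle) for each classical crossing and a band ($1$-handle) for each edge (edges run from classical crossing to classical crossing, possibly through virtual crossings), attached in the natural fashion, so the diagram becomes a 4-valent graph in $F$ with no virtual crossings. The diagram is checkerboard colorable if the components of the complement of this graph in $F$ can be colored with two colors so that the two sides of each edge have different colors. A virtual link is checkerboard colorable if it has a checkerboard colorable diagram (virtual links are virtual diagrams up to generalized Reidemeister moves). Equivalently, the link has an oriented diagram admitting a (mod 2)-Alexander numbering: an assignment of elements of $\mathbb{Z}_2$ to the edges such that at every classical crossing, drawn with both strands downward, the two left edges receive the same $i$ and the two right edges receive $i+1$. *)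

theory Defs
  imports Main
begin

text \<open>
  A virtual link diagram is an oriented immersed plane curve in general position with respect to the
  height function, cut from top to bottom into slices.  Each slice contains a single local maximum,
  local minimum, classical crossing or virtual crossing; all other strands run through it
  vertically.  Between two slices one sees finitely many strand points, numbered from left to right
  starting at 0, each of which is traversed downward or upward.
\<close>

datatype dir = Down | Up

fun opp :: "dir \<Rightarrow> dir" where
  "opp Down = Up"
| "opp Up = Down"

text \<open>
  Crossings are typed by their position in the plane, not by their sign: \<open>Over_NW\<close> means that the
  strand joining the upper left to the lower right end is the overcrossing strand, \<open>Over_NE\<close> that
  it is the strand joining the upper right to the lower left end.
\<close>

datatype crossing = Over_NW | Over_NE | Virtual

fun switch :: "crossing \<Rightarrow> crossing" where
  "switch Over_NW = Over_NE"
| "switch Over_NE = Over_NW"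
| "switch Virtual = Virtual"

text \<open>
  \<open>Cap d\<close> is a local maximum whose left leg has direction \<open>d\<close>; \<open>Cup\<close> is a local minimum.
  In a slice \<open>(e, p)\<close>, the number \<open>p\<close> is the position of the leftmost strand point involved in \<open>e\<close>.
\<close>

datatype event = Cap dir | Cup | Cross crossing

type_synonym diagram = "(event \<times> nat) list"

fun ins :: "event \<Rightarrow> nat" where
  "ins (Cap d) = 0"
| "ins Cup = 2"
| "ins (Cross t) = 2"

fun outs :: "event \<Rightarrow> nat" where
  "outs (Cap d) = 2"
| "outs Cup = 0"
| "outs (Cross t) = 2"

fun slice :: "event \<times> nat \<Rightarrow> dir list \<Rightarrow> dir list option" where
  "slice (Cap d, p) w =
     (if p \<le> length w then Some (take p w @ [d, opp d] @ drop p w) else None)"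
| "slice (Cup, p) w =
     (if p + 1 < length w \<and> w ! (p + 1) = opp (w ! p)
      then Some (take p w @ drop (p + 2) w) else None)"
| "slice (Cross t, p) w =
     (if p + 1 < length w then Some (w[p := w ! (p + 1), p + 1 := w ! p]) else None)"

fun run :: "diagram \<Rightarrow> dir list \<Rightarrow> dir list option" where
  "run [] w = Some w"
| "run (s # D) w = Option.bind (slice s w) (run D)"

definition virtual_link_diagram :: "diagram \<Rightarrow> bool" where
  "virtual_link_diagram D \<longleftrightarrow> run D [] = Some []"

text \<open>The directions of the strand points after the first \<open>n\<close> slices.\<close>

definition level :: "diagram \<Rightarrow> nat \<Rightarrow> dir list" where
  "level D n = the (run (take n D) [])"


section \<open>Generalized Reidemeister moves\<close>

text \<open>
  The first group of rules is planar isotopy of sliced diagrams: two slices in disjoint vertical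
  strips exchange heights, a maximum cancels against a minimum, and a crossing is pushed across a
  maximum or minimum (the strand passing through the arch keeps its over/under/virtual role, whence
  \<open>switch\<close>).  A variable \<open>t\<close> ranging over all crossings yields a classical move and its virtual
  counterpart at once.  As the directions are determined by the surrounding diagram, every rule
  covers all compatible orientations.

  In the rules for three strands \<open>P\<close>, \<open>Q\<close>, \<open>R\<close> (from left to right at the top) \<open>a\<close>, \<open>b\<close>, \<open>c\<close> are
  the crossings of \<open>P\<close> with \<open>Q\<close>, of \<open>P\<close> with \<open>R\<close>, and of \<open>Q\<close> with \<open>R\<close>.  If all are classical, then
  \<open>a = c \<noteq> b\<close> is the cyclic pattern, in which no strand lies above both others.  With exactly one
  virtual crossing the move is forbidden.
\<close>

definition triple_left :: "crossing \<Rightarrow> crossing \<Rightarrow> crossing \<Rightarrow> nat \<Rightarrow> diagram" where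
  "triple_left a b c p = [(Cross a, p), (Cross b, p + 1), (Cross c, p)]"

definition triple_right :: "crossing \<Rightarrow> crossing \<Rightarrow> crossing \<Rightarrow> nat \<Rightarrow> diagram" where
  "triple_right a b c p = [(Cross c, p + 1), (Cross b, p), (Cross a, p + 1)]"

inductive local_move :: "diagram \<Rightarrow> diagram \<Rightarrow> bool" where
  exchange: "local_move [(e, p), (f, p + outs e + m)] [(f, p + ins e + m), (e, p)]"
| zigzag_left: "local_move [(Cap d, p + 1), (Cup, p)] []"
| zigzag_right: "local_move [(Cap d, p), (Cup, p + 1)] []"
| slide_cap: "local_move [(Cap d, p), (Cross t, p + 1)] [(Cap d, p + 1), (Cross (switch t), p)]"
| slide_cup: "local_move [(Cross t, p + 1), (Cup, p)] [(Cross (switch t), p), (Cup, p + 1)]"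
| R1_right: "local_move [(Cap d, p + 1), (Cross t, p), (Cup, p + 1)] []"
| R1_left: "local_move [(Cap d, p), (Cross t, p + 1), (Cup, p)] []"
| R2: "local_move [(Cross t, p), (Cross (switch t), p)] []"
| R3: "\<lbrakk>Virtual \<notin> {a, b, c}; \<not> (a = c \<and> a \<noteq> b)\<rbrakk>
    \<Longrightarrow> local_move (triple_left a b c p) (triple_right a b c p)"
| VR3_PQ: "local_move (triple_left t Virtual Virtual p) (triple_right t Virtual Virtual p)"
| VR3_PR: "local_move (triple_left Virtual t Virtual p) (triple_right Virtual t Virtual p)"
| VR3_QR: "local_move (triple_left Virtual Virtual t p) (triple_right Virtual Virtual t p)"

inductive diagram_move :: "diagram \<Rightarrow> diagram \<Rightarrow> bool" where
  "\<lbrakk>local_move L R; virtual_link_diagram (A @ L @ B); virtual_link_diagram (A @ R @ B)\<rbrakk>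
    \<Longrightarrow> diagram_move (A @ L @ B) (A @ R @ B)"

text \<open>An oriented virtual link is represented by the set of its diagrams.\<close>

definition virtual_link :: "diagram \<Rightarrow> diagram set" where
  "virtual_link D = {D'. virtual_link_diagram D' \<and> equivclp diagram_move D D'}"


section \<open>Checkerboard colorability\<close>

text \<open>
  Let \<open>F\<close> be the surface with a disk for each classical crossing and a band for each edge.  Near the
  strand point \<open>i\<close> after \<open>n\<close> slices the graph cuts its band into a west and an east half,
  \<open>(n, i, West)\<close> and \<open>(n, i, East)\<close>.  The relation \<open>adjacent D\<close> says which of these pieces of the
  complement of the graph in \<open>F\<close> meet inside a slice.  Bands pass a virtual crossing without
  touching each other; at a classical crossing the complement in the disk consists of the north,
  west, east and south corners.
\<close>

datatype side = West | East

type_synonym half_band = "nat \<times> nat \<times> side"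

inductive adjacent :: "diagram \<Rightarrow> half_band \<Rightarrow> half_band \<Rightarrow> bool" for D where
  pass_left: "\<lbrakk>n < length D; D ! n = (e, p); i < p\<rbrakk>
    \<Longrightarrow> adjacent D (n, i, s) (Suc n, i, s)"
| pass_right: "\<lbrakk>n < length D; D ! n = (e, p); p + ins e + m < length (level D n)\<rbrakk>
    \<Longrightarrow> adjacent D (n, p + ins e + m, s) (Suc n, p + outs e + m, s)"
| cap_outer: "\<lbrakk>n < length D; D ! n = (Cap d, p)\<rbrakk>
    \<Longrightarrow> adjacent D (Suc n, p, West) (Suc n, p + 1, East)"
| cap_inner: "\<lbrakk>n < length D; D ! n = (Cap d, p)\<rbrakk>
    \<Longrightarrow> adjacent D (Suc n, p, East) (Suc n, p + 1, West)"
| cup_outer: "\<lbrakk>n < length D; D ! n = (Cup, p)\<rbrakk>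
    \<Longrightarrow> adjacent D (n, p, West) (n, p + 1, East)"
| cup_inner: "\<lbrakk>n < length D; D ! n = (Cup, p)\<rbrakk>
    \<Longrightarrow> adjacent D (n, p, East) (n, p + 1, West)"
| virtual_NW_SE: "\<lbrakk>n < length D; D ! n = (Cross Virtual, p)\<rbrakk>
    \<Longrightarrow> adjacent D (n, p, s) (Suc n, p + 1, s)"
| virtual_NE_SW: "\<lbrakk>n < length D; D ! n = (Cross Virtual, p)\<rbrakk>
    \<Longrightarrow> adjacent D (n, p + 1, s) (Suc n, p, s)"
| corner_north: "\<lbrakk>n < length D; D ! n = (Cross t, p); t \<noteq> Virtual\<rbrakk>
    \<Longrightarrow> adjacent D (n, p, East) (n, p + 1, West)"
| corner_south: "\<lbrakk>n < length D; D ! n = (Cross t, p); t \<noteq> Virtual\<rbrakk>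
    \<Longrightarrow> adjacent D (Suc n, p, East) (Suc n, p + 1, West)"
| corner_west: "\<lbrakk>n < length D; D ! n = (Cross t, p); t \<noteq> Virtual\<rbrakk>
    \<Longrightarrow> adjacent D (n, p, West) (Suc n, p, West)"
| corner_east: "\<lbrakk>n < length D; D ! n = (Cross t, p); t \<noteq> Virtual\<rbrakk>
    \<Longrightarrow> adjacent D (n, p + 1, East) (Suc n, p + 1, East)"

text \<open>The component of the complement of the graph in \<open>F\<close> that contains a given half band.\<close>

definition region :: "diagram \<Rightarrow> half_band \<Rightarrow> half_band set" where
  "region D h = {h'. equivclp (adjacent D) h h'}"

definition checkerboard_colorable_diagram :: "diagram \<Rightarrow> bool" where
  "checkerboard_colorable_diagram D \<longleftrightarrow>
     (\<exists>color :: half_band set \<Rightarrow> bool.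
        \<forall>n \<le> length D. \<forall>i < length (level D n).
          color (region D (n, i, West)) \<noteq> color (region D (n, i, East)))"

definition checkerboard_colorable :: "diagram set \<Rightarrow> bool" where
  "checkerboard_colorable L \<longleftrightarrow> (\<exists>D \<in> L. checkerboard_colorable_diagram D)"


section \<open>Closures of virtual braids\<close>

text \<open>
  Braid words are read from top to bottom, with all braid strands oriented downward.  The
  letters \<open>Sigma i\<close>, \<open>Sigma_inv i\<close> and \<open>Vi i\<close> act on the strands number \<open>i\<close> and \<open>i + 1\<close>,
  where the leftmost strand has number 1.  \<open>Sigma i\<close> is the positive crossing.
\<close>

datatype braid_letter = Sigma nat | Sigma_inv nat | Vi nat

fun letter_slice :: "braid_letter \<Rightarrow> event \<times> nat" where
  "letter_slice (Sigma i) = (Cross Over_NE, i - 1)"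
| "letter_slice (Sigma_inv i) = (Cross Over_NW, i - 1)"
| "letter_slice (Vi i) = (Cross Virtual, i - 1)"

definition sigma_power :: "nat \<Rightarrow> int \<Rightarrow> braid_letter list" where
  "sigma_power i k = replicate (nat \<bar>k\<bar>) (if k \<ge> 0 then Sigma i else Sigma_inv i)"

text \<open>The \<open>n\<close> closing arcs run parallel, to the right of the braid.\<close>

definition braid_closure :: "nat \<Rightarrow> braid_letter list \<Rightarrow> diagram" where
  "braid_closure n w =
     map (\<lambda>j. (Cap Down, j)) [0..<n] @ map letter_slice w @ map (\<lambda>j. (Cup, j)) (rev [0..<n])"

definition VT2 :: "int \<Rightarrow> diagram set" where
  "VT2 k = virtual_link (braid_closure 2 (sigma_power 1 k @ [Vi 1]))"

lemma run_append: "run (A @ B) w = Option.bind (run A w) (run B)"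
  by (induction A arbitrary: w) (auto split: bind_splits)

lemma virtual_link_diagram_VT2:
  "virtual_link_diagram (braid_closure 2 (sigma_power 1 k @ [Vi 1]))"
proof -
  have cross: "run (replicate m (Cross t, 0)) [Down, Down, Up, Up] = Some [Down, Down, Up, Up]"
    for m t by (induction m) auto
  have "[0..<2] = [0, 1::nat]" by (simp add: upt_rec)
  then show ?thesis
    by (simp add: virtual_link_diagram_def braid_closure_def sigma_power_def run_append cross
        map_replicate)
qed

lemma VT2_nonempty: "VT2 k \<noteq> {}"
proof -
  let ?D = "braid_closure 2 (sigma_power 1 k @ [Vi 1])"
  have "equivclp diagram_move ?D ?D" by (rule equivclp_refl)
  then have "?D \<in> VT2 k" using virtual_link_diagram_VT2 by (simp add: VT2_def virtual_link_def)
  then show ?thesis by blast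
qed

end

theory Submission imports Defs begin

text \<open>
  Colour the strand points of a diagram by bits such that the bit changes at every passage through a
  classical crossing and at every maximum and minimum.  Weight such a colouring with the sum of the
  signs of those crossings at which the two strands have equal bits; for a knot this is the odd
  writhe.  The set of weights of all colourings is an invariant, since it can be
  computed slice by slice.  The colours of the west sides of the strands in a checkerboard colouring
  form such a colouring in which the strands at a crossing always have different bits, so that the
  weight is 0.  The diagram of \<open>VT2 k\<close> has no colouring for odd \<open>k\<close>, and only colourings of
  weight \<open>k\<close> for even \<open>k\<close>.
\<close>

section \<open>Colourings by bits\<close>

type_synonym strand = "dir \<times> bool"

text \<open>The bit stands for the colour west of the strand in the plane, not on its left with
  respect to the orientation. The west side of one leg of an arch continues as the east side of the
  other, so the bit flips.\<close>

definition turn :: "strand \<Rightarrow> strand" where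
  "turn x = (opp (fst x), \<not> snd x)"

definition pass :: "crossing \<Rightarrow> strand \<Rightarrow> strand" where
  "pass t x = (fst x, snd x = (t = Virtual))"

text \<open>The sign of a crossing whose strands have the same vertical direction.\<close>

fun parallel_sign :: "crossing \<Rightarrow> int" where
  "parallel_sign Over_NW = - 1"
| "parallel_sign Over_NE = 1"
| "parallel_sign Virtual = 0"

text \<open>Reversing exactly one of the two strands reverses the sign of a crossing, whence the
  minus for opposite directions.\<close>

definition weight :: "crossing \<Rightarrow> strand \<Rightarrow> strand \<Rightarrow> int" where
  "weight t x y =
     (if snd x = snd y then if fst x = fst y then parallel_sign t else - parallel_sign t else 0)"

text \<open>A relation rather than a function: the bit at a maximum is a free choice, and a minimum
  accepts only matching legs.\<close>

fun event_coloring :: "event \<Rightarrow> strand list \<Rightarrow> strand list \<Rightarrow> int \<Rightarrow> bool" where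
  "event_coloring (Cap d) xs ys z \<longleftrightarrow> xs = [] \<and> (\<exists>x. fst x = d \<and> ys = [x, turn x]) \<and> z = 0"
| "event_coloring Cup xs ys z \<longleftrightarrow> (\<exists>x. xs = [x, turn x]) \<and> ys = [] \<and> z = 0"
| "event_coloring (Cross t) xs ys z \<longleftrightarrow>
     (\<exists>x y. xs = [x, y] \<and> ys = [pass t y, pass t x] \<and> z = weight t x y)"

fun slice_coloring :: "event \<times> nat \<Rightarrow> strand list \<Rightarrow> strand list \<Rightarrow> int \<Rightarrow> bool" where
  "slice_coloring (e, p) w w' z \<longleftrightarrow>
     (\<exists>u xs ys v. length u = p \<and> w = u @ xs @ v \<and> w' = u @ ys @ v \<and> event_coloring e xs ys z)"

fun coloring :: "diagram \<Rightarrow> strand list \<Rightarrow> strand list \<Rightarrow> int \<Rightarrow> bool" where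
  "coloring [] w w' z \<longleftrightarrow> w' = w \<and> z = 0"
| "coloring (s # D) w w' z \<longleftrightarrow>
     (\<exists>w1 z1 z2. slice_coloring s w w1 z1 \<and> coloring D w1 w' z2 \<and> z = z1 + z2)"

declare slice_coloring.simps [simp del] split_paired_Ex [simp del]

lemma coloring_append:
  "coloring (A @ B) w w' z \<longleftrightarrow>
     (\<exists>w1 z1 z2. coloring A w w1 z1 \<and> coloring B w1 w' z2 \<and> z = z1 + z2)"
proof (induction A arbitrary: w z)
  case (Cons s A)
  have "coloring ((s # A) @ B) w w' z \<longleftrightarrow> (\<exists>w1 z1 w2 z2 z3. slice_coloring s w w1 z1 \<and>
      coloring A w1 w2 z2 \<and> coloring B w2 w' z3 \<and> z = z1 + (z2 + z3))"
    unfolding append_Cons coloring.simps Cons.IH by blast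
  also have "\<dots> \<longleftrightarrow> (\<exists>w1 z1 w2 z2 z3. slice_coloring s w w1 z1 \<and>
      coloring A w1 w2 z2 \<and> coloring B w2 w' z3 \<and> z = (z1 + z2) + z3)"
    by (simp only: add.assoc)
  also have "\<dots> \<longleftrightarrow>
      (\<exists>w1 z1 z2. coloring (s # A) w w1 z1 \<and> coloring B w1 w' z2 \<and> z = z1 + z2)"
    unfolding coloring.simps by blast
  finally show ?case .
qed simp

lemma opp_eq_iff [simp]: "opp a = opp b \<longleftrightarrow> a = b"
  by (cases a; cases b) auto

lemma opp_opp [simp]: "opp (opp a) = a"
  by (cases a) auto

lemma turn_turn [simp]: "turn (turn x) = x"
  by (simp add: turn_def)

lemma fst_turn [simp]: "fst (turn x) = opp (fst x)"
  by (simp add: turn_def)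

lemma fst_pass [simp]: "fst (pass t x) = fst x"
  by (simp add: pass_def)

lemma event_coloring_length:
  "event_coloring e xs ys z \<Longrightarrow> length xs = ins e \<and> length ys = outs e"
  by (cases e) auto

lemma slice_coloring_run:
  assumes "slice_coloring s w w' z"
  shows "slice s (map fst w) = Some (map fst w')"
proof -
  obtain e p where s: "s = (e, p)" by (cases s)
  show ?thesis
    using assms by (cases e) (auto simp: s slice_coloring.simps nth_append list_update_append)
qed

text \<open>Forgetting the bits leaves the directions, so the validity of a diagram yields
  information about its coloured states.\<close>

lemma coloring_run: "coloring D w w' z \<Longrightarrow> run D (map fst w) = Some (map fst w')"
proof (induction D arbitrary: w z)
  case (Cons s D)
  then obtain w1 z1 z2 where "slice_coloring s w w1 z1" "coloring D w1 w' z2" by auto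
  then show ?case using Cons.IH by (simp add: slice_coloring_run)
qed simp

section \<open>Evaluating colourings at a known position\<close>

text \<open>The numbers \<open>p\<close> and \<open>ins e\<close> determine where the state has to
  be cut, so the decomposition is unique.\<close>

lemma slice_coloring_at:
  assumes "length xs = ins e" "length u = p"
  shows "slice_coloring (e, p) (u @ xs @ v) w' z \<longleftrightarrow>
    (\<exists>ys. event_coloring e xs ys z \<and> w' = u @ ys @ v)"
proof
  assume "slice_coloring (e, p) (u @ xs @ v) w' z"
  then obtain u1 xs1 ys v1 where 1: "length u1 = p" "u @ xs @ v = u1 @ xs1 @ v1"
      "w' = u1 @ ys @ v1" "event_coloring e xs1 ys z"
    unfolding slice_coloring.simps by blast
  then have "length xs1 = length xs" using assms event_coloring_length by simp
  then have "u1 = u" "xs1 = xs" "v1 = v" using 1(1,2) assms(2) by simp_all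
  then show "\<exists>ys. event_coloring e xs ys z \<and> w' = u @ ys @ v" using 1 by blast
qed (use assms slice_coloring.simps in blast)

lemma coloring_at:
  assumes "length xs = ins e" "length u = p"
  shows "coloring ((e, p) # D) (u @ xs @ v) w' z \<longleftrightarrow>
    (\<exists>ys z1. event_coloring e xs ys z1 \<and> coloring D (u @ ys @ v) w' (z - z1))"
proof -
  have z: "z = z1 + z2 \<longleftrightarrow> z2 = z - z1" for z1 z2 by auto
  show ?thesis unfolding coloring.simps slice_coloring_at[OF assms] z by blast
qed

lemma coloring_cap:
  assumes "length u = p"
  shows "coloring ((Cap d, p) # D) (u @ v) w' z \<longleftrightarrow>
    (\<exists>x. fst x = d \<and> coloring D (u @ x # turn x # v) w' z)"
proof -
  have "coloring ((Cap d, p) # D) (u @ [] @ v) w' z \<longleftrightarrow>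
      (\<exists>x. fst x = d \<and> coloring D (u @ [x, turn x] @ v) w' (z - 0))"
    unfolding coloring_at[of "[]" "Cap d", simplified ins.simps list.size, OF refl assms]
      event_coloring.simps by blast
  then show ?thesis by simp
qed

lemma coloring_cup:
  assumes "length u = p"
  shows "coloring ((Cup, p) # D) (u @ x # y # v) w' z \<longleftrightarrow> y = turn x \<and> coloring D (u @ v) w' z"
  using coloring_at[of "[x, y]" Cup u p D v w' z] assms by simp

lemma coloring_cross:
  assumes "length u = p"
  shows "coloring ((Cross t, p) # D) (u @ x # y # v) w' z \<longleftrightarrow>
    coloring D (u @ pass t y # pass t x # v) w' (z - weight t x y)"
  using coloring_at[of "[x, y]" "Cross t" u p D v w' z] assms by simp

declare coloring.simps(2) [simp del]

text \<open>The instances with \<open>u @ [a]\<close> serve the events one position further right,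
  as they occur in the moves.\<close>

lemmas coloring_local =
  coloring_cap coloring_cup coloring_cross
  coloring_cap[of "u @ [a]" for u a, simplified]
  coloring_cup[of "u @ [a]" for u a, simplified]
  coloring_cross[of "u @ [a]" for u a, simplified]


section \<open>Invariance under the moves\<close>

lemma split_at:
  assumes "p + n \<le> length w"
  obtains u xs v where "w = u @ xs @ v" "length u = p" "length xs = n"
proof
  show "w = take p w @ take n (drop p w) @ drop n (drop p w)" by (simp only: append_take_drop_id)
qed (use assms in auto)

lemma slice_bound: "slice (e, p) w \<noteq> None \<Longrightarrow> p + ins e \<le> length w"
  by (cases e) (auto split: if_splits)

lemma slice_length: "slice (e, p) w = Some w' \<Longrightarrow> length w' + ins e = length w + outs e"
  by (cases e) (auto split: if_splits)

lemma coloring_two: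
  "coloring [s, s'] w w' z \<longleftrightarrow>
     (\<exists>w1 z1 z2. slice_coloring s w w1 z1 \<and> slice_coloring s' w1 w' z2 \<and> z = z1 + z2)"
  by (simp add: coloring.simps(2))

text \<open>The events act on disjoint blocks \<open>xe\<close> and \<open>xf\<close>, separated by
  the \<open>m\<close> strands \<open>r\<close>. In either order the colourings are pairs of
  independent choices for the two blocks, and the weights add.\<close>

lemma coloring_exchange:
  assumes "run [(e, p), (f, p + outs e + m)] (map fst w) \<noteq> None"
  shows "coloring [(e, p), (f, p + outs e + m)] w w' z \<longleftrightarrow>
    coloring [(f, p + ins e + m), (e, p)] w w' z"
proof -
  obtain w1 where w1: "slice (e, p) (map fst w) = Some w1" "slice (f, p + outs e + m) w1 \<noteq> None"
    using assms by (auto split: bind_splits)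
  \<comment> \<open>The lower event fits below \<open>e\<close>; correcting for the change of length
    caused by \<open>e\<close> gives room for both blocks in \<open>w\<close>.\<close>
  have le: "p + ins e + m + ins f \<le> length w"
    using slice_bound[OF w1(2)] slice_length[OF w1(1)] by simp
  obtain q xf v where q: "w = q @ xf @ v" "length q = p + ins e + m" "length xf = ins f"
    using le by (rule split_at)
  obtain u xe r where r: "q = u @ xe @ r" "length u = p" "length xe = ins e"
    by (rule split_at[of p "ins e" q]) (use q in auto)
  have m: "length r = m" using q(2) r by simp
  have w: "w = u @ xe @ (r @ xf @ v)" "w = (u @ xe @ r) @ xf @ v"
    using q r by simp_all
  have 1: "slice_coloring (f, p + outs e + m) (u @ ye @ (r @ xf @ v)) w' z' \<longleftrightarrow>
      (\<exists>yf. event_coloring f xf yf z' \<and> w' = u @ ye @ r @ yf @ v)"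
    if "event_coloring e xe ye z1" for ye z1 w' z'
    using slice_coloring_at[of xf f "u @ ye @ r" "p + outs e + m" v w' z']
      event_coloring_length[OF that] q r m by simp
  have 2: "slice_coloring (e, p) ((u @ xe @ r) @ yf @ v) w' z' \<longleftrightarrow>
      (\<exists>ye. event_coloring e xe ye z' \<and> w' = u @ ye @ r @ yf @ v)" for yf w' z'
    using slice_coloring_at[of xe e u p "r @ yf @ v" w' z'] r by simp
  have L: "coloring [(e, p), (f, p + outs e + m)] w w' z \<longleftrightarrow>
      (\<exists>ye yf z1 z2. event_coloring e xe ye z1 \<and> event_coloring f xf yf z2 \<and>
        w' = u @ ye @ r @ yf @ v \<and> z = z1 + z2)"
    unfolding coloring_two w(1) slice_coloring_at[OF r(3,2)] using 1 by blast
  have R: "coloring [(f, p + ins e + m), (e, p)] w w' z \<longleftrightarrow>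
      (\<exists>ye yf z1 z2. event_coloring e xe ye z1 \<and> event_coloring f xf yf z2 \<and>
        w' = u @ ye @ r @ yf @ v \<and> z = z2 + z1)"
    unfolding coloring_two w(2) slice_coloring_at[OF q(3) q(2)[unfolded r(1)]] using 2 by blast
  show ?thesis unfolding L R by (simp add: add.commute)
qed

lemma split_at_Suc:
  assumes "Suc p \<le> length w"
  obtains u x v where "w = u @ x # v" "length u = p"
  using id_take_nth_drop[of p w] assms by (metis Suc_le_lessD length_take min.absorb4)

lemma split_at_2:
  assumes "p + 2 \<le> length w"
  obtains u x y v where "w = u @ x # y # v" "length u = p"
proof -
  obtain u xs v where "w = u @ xs @ v" "length u = p" "length xs = 2"
    using assms by (rule split_at)
  then show ?thesis using that by (auto simp: numeral_2_eq_2 length_Suc_conv)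
qed

lemma split_at_3:
  assumes "p + 3 \<le> length w"
  obtains u x y y' v where "w = u @ x # y # y' # v" "length u = p"
proof -
  obtain u xs v where "w = u @ xs @ v" "length u = p" "length xs = 3"
    using assms by (rule split_at)
  then show ?thesis using that by (auto simp: numeral_3_eq_3 length_Suc_conv)
qed

section \<open>Algebra of turns, passages and weights\<close>

lemma pass_pass [simp]: "pass t (pass t x) = x" "pass (switch t) = pass t"
  by (cases t; auto simp: pass_def)+

lemma pass_turn: "pass t (turn x) = turn (pass t x)"
  by (auto simp: pass_def turn_def)

text \<open>Exchanging over and under reverses the sign. This cancels the two crossings of a second
  Reidemeister move.\<close>

lemma weight_switch: "weight (switch t) y x = - weight t x y"
  by (cases t) (auto simp: weight_def)

lemma weight_pass_pass: "weight t (pass s x) (pass s y) = weight t x y"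
  by (auto simp: weight_def pass_def)

text \<open>The weight depends on the bits only through their agreement, which changes in the same
  way whichever of the two is flipped.\<close>

lemma weight_pass: "weight t (pass s x) y = weight t x (pass s y)"
  by (auto simp: weight_def pass_def)

text \<open>The strand returns to the classical crossing of a kink with the other bit, and a virtual
  crossing has sign 0. Hence kinks contribute nothing.\<close>

lemma weight_loop: "weight t x (pass t x) = 0"
  by (cases t) (auto simp: weight_def pass_def)

text \<open>For a classical crossing, the reversed direction on the left and \<open>switch\<close>
  on the right both reverse the sign, while \<open>turn\<close> and \<open>pass t\<close> both flip
  the bit. This is what sliding a strand across an arch requires.\<close>

lemma weight_turn_pass: "weight t (turn x) y = weight (switch t) y (pass t x)"
proof -
  have "opp a = b \<longleftrightarrow> a \<noteq> b" for a b by (cases a; cases b) auto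
  then show ?thesis by (cases t) (auto simp: weight_def turn_def pass_def)
qed

lemma turn_eq_iff: "turn x = turn y \<longleftrightarrow> x = y" "x = turn y \<longleftrightarrow> turn x = y"
  by (metis turn_turn)+

lemma virtual_trivial [simp]: "pass Virtual x = x" "weight Virtual x y = 0"
  by (simp_all add: pass_def weight_def)

lemma pass_classical: "s \<noteq> Virtual \<Longrightarrow> t \<noteq> Virtual \<Longrightarrow> pass s x = pass t x"
  by (simp add: pass_def)

text \<open>The weights agree crossing by crossing. If all three are classical, the strands of
  \<open>a\<close> and of \<open>c\<close> meet with both bits flipped or neither, and at
  \<open>b\<close> one bit is flipped on either side. With two virtual crossings no bit changes
  before the third crossing. With exactly one virtual crossing, the two sides compare different
  bits.\<close>

lemma coloring_triple:
  assumes "p + 3 \<le> length w"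
    and "a = Virtual \<and> b = Virtual \<or> a = Virtual \<and> c = Virtual \<or> b = Virtual \<and> c = Virtual
      \<or> Virtual \<notin> {a, b, c}"
  shows "coloring (triple_left a b c p) w w' z \<longleftrightarrow> coloring (triple_right a b c p) w w' z"
proof -
  obtain u x y y' v where w: "w = u @ x # y # y' # v" "length u = p"
    using assms(1) by (rule split_at_3)
  have weights: "weight a x y + weight b (pass a x) y' + weight c (pass a y) (pass b y') =
      weight c y y' + weight b x (pass c y') + weight a (pass b x) (pass c y)"
    using assms(2)
  proof (elim disjE conjE)
    assume "Virtual \<notin> {a, b, c}"
    then have "pass a = pass b" "pass c = pass b" by (auto intro: pass_classical)
    then show ?thesis by (simp add: weight_pass weight_pass_pass)
  qed simp_all
  have "pass b (pass a x) = pass a (pass b x)" for a b x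
    by (auto simp: pass_def)
  then show ?thesis
    unfolding triple_left_def triple_right_def w(1) using w(2) weights
    by (auto simp: coloring_local)
qed

text \<open>Definedness of the runs provides enough strands at position \<open>p\<close> and, where
  an arch is removed, the direction of the strand that carries it.\<close>

lemma local_move_coloring:
  assumes "local_move L R"
    and "run L (map fst w) \<noteq> None" "run R (map fst w) \<noteq> None"
  shows "coloring L w w' z \<longleftrightarrow> coloring R w w' z"
  using assms
proof (cases rule: local_move.cases)
  case (exchange e p f m)
  then show ?thesis using coloring_exchange assms(2) by simp
next
  case (zigzag_left d p)
  then have "Suc p \<le> length w" using assms(2) by (auto split: bind_splits if_splits)
  then obtain u x v where w: "w = u @ x # v" "length u = p" by (rule split_at_Suc)
  \<comment> \<open>The maximum fits only one direction of the strand. For the other direction the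
    left side has no colouring, whereas the empty diagram has one.\<close>
  have "fst x = opp d"
    using assms(2) w unfolding zigzag_left
    by (auto split: bind_splits if_splits simp: nth_append)
  then show ?thesis
    unfolding zigzag_left w(1) using w(2)
    by (auto simp: coloring_local turn_eq_iff(2))
next
  case (zigzag_right d p)
  have "Suc p \<le> length w" using assms(2) unfolding zigzag_right
    by (auto split: bind_splits if_splits)
  then obtain u x v where w: "w = u @ x # v" "length u = p" by (rule split_at_Suc)
  have "fst x = d"
    using assms(2) w unfolding zigzag_right
    by (auto split: bind_splits if_splits simp: nth_append)
  then show ?thesis
    unfolding zigzag_right w(1) using w(2)
    by (auto simp: coloring_local)
next
  case (slide_cap d p t)
  have "Suc p \<le> length w" using assms(3) unfolding slide_cap
    by (auto split: bind_splits if_splits)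
  then obtain u x v where w: "w = u @ x # v" "length u = p" by (rule split_at_Suc)
  have "coloring L w w' z \<longleftrightarrow> (\<exists>y. fst y = d \<and>
      w' = u @ y # pass t x # pass t (turn y) # v \<and> z = weight t (turn y) x)"
    unfolding slide_cap w(1) using w(2) by (auto simp: coloring_local)
  \<comment> \<open>Substitute \<open>pass t y\<close> for \<open>y\<close>: moving the crossing to
    the other leg exchanges the parts of the arch before and after the crossing.\<close>
  also have "\<dots> \<longleftrightarrow> (\<exists>y. fst y = d \<and>
      w' = u @ pass t y # pass t x # turn y # v \<and> z = weight (switch t) x y)"
    by (metis pass_pass(1) fst_pass pass_turn weight_turn_pass)
  also have "\<dots> \<longleftrightarrow> coloring R w w' z"
    unfolding slide_cap w(1) using w(2) by (auto simp: coloring_local)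
  finally show ?thesis .
next
  case (slide_cup t p)
  have "p + 3 \<le> length w" using assms(2) unfolding slide_cup
    by (auto split: bind_splits if_splits)
  then obtain u x y y' v where w: "w = u @ x # y # y' # v" "length u = p" by (rule split_at_3)
  have "weight t y (turn (pass t x)) = weight (switch t) x y"
    using weight_turn_pass[of "switch t" "pass t x" y] by (simp add: weight_switch)
  moreover have "pass t y' = turn x \<longleftrightarrow> y' = turn (pass t x)"
    by (metis pass_pass(1) pass_turn)
  ultimately show ?thesis
    unfolding slide_cup w(1) using w(2) by (auto simp: coloring_local)
next
  case (R1_right d p t)
  have "Suc p \<le> length w" using assms(2) unfolding R1_right
    by (auto split: bind_splits if_splits)
  then obtain u x v where w: "w = u @ x # v" "length u = p" by (rule split_at_Suc)
  have "fst x = d"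
    using assms(2) w unfolding R1_right
    by (auto split: bind_splits if_splits simp: nth_append)
  \<comment> \<open>The minimum forces the left leg of the maximum to be \<open>pass t x\<close>;
    the second passage then restores \<open>x\<close>, with weight 0.\<close>
  then show ?thesis
    unfolding R1_right w(1) using w(2)
    by (auto simp: coloring_local weight_loop turn_eq_iff(1))
next
  case (R1_left d p t)
  have "Suc p \<le> length w" using assms(2) unfolding R1_left
    by (auto split: bind_splits if_splits)
  then obtain u x v where w: "w = u @ x # v" "length u = p" by (rule split_at_Suc)
  have "fst x = opp d"
    using assms(2) w unfolding R1_left
    by (auto split: bind_splits if_splits simp: nth_append)
  moreover have "pass t x = turn y \<longleftrightarrow> y = turn (pass t x)" for y by (metis turn_turn)
  ultimately show ?thesis
    unfolding R1_left w(1) using w(2)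
    by (auto simp: coloring_local weight_loop weight_pass pass_turn)
next
  case (R2 t p)
  have "p + 2 \<le> length w" using assms(2) unfolding R2
    by (auto split: bind_splits if_splits)
  then obtain u x y v where w: "w = u @ x # y # v" "length u = p" by (rule split_at_2)
  show ?thesis
    unfolding R2 w(1) using w(2)
    by (auto simp: coloring_local weight_switch weight_pass_pass)
next
  case (R3 a b c p)
  have "p + 3 \<le> length w" using assms(2) unfolding R3 triple_left_def
    by (auto split: bind_splits if_splits)
  then show ?thesis unfolding R3 by (rule coloring_triple) (use R3 in auto)
next
  case (VR3_PQ t p)
  have "p + 3 \<le> length w" using assms(2) unfolding VR3_PQ triple_left_def
    by (auto split: bind_splits if_splits)
  then show ?thesis unfolding VR3_PQ by (rule coloring_triple) auto
next
  case (VR3_PR t p)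
  have "p + 3 \<le> length w" using assms(2) unfolding VR3_PR triple_left_def
    by (auto split: bind_splits if_splits)
  then show ?thesis unfolding VR3_PR by (rule coloring_triple) auto
next
  case (VR3_QR t p)
  have "p + 3 \<le> length w" using assms(2) unfolding VR3_QR triple_left_def
    by (auto split: bind_splits if_splits)
  then show ?thesis unfolding VR3_QR by (rule coloring_triple) auto
qed

section \<open>From local moves to virtual links\<close>

lemma diagram_move_coloring:
  assumes "diagram_move D D'"
  shows "coloring D [] [] z \<longleftrightarrow> coloring D' [] [] z"
  using assms
proof cases
  case (1 L R A B)
  \<comment> \<open>The local lemma needs both pieces to run from the directions of
    \<open>w\<close>. A colouring of the prefix \<open>A\<close> identifies these as the directions
    reached by \<open>A\<close>, and both whole diagrams are valid.\<close>
  have "coloring L w w' z' \<longleftrightarrow> coloring R w w' z'" if "coloring A [] w z1" for w w' z' z1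
  proof -
    have "run A [] = Some (map fst w)" using coloring_run[OF that] by simp
    then have "run L (map fst w) \<noteq> None" "run R (map fst w) \<noteq> None"
      using 1(4,5) by (auto simp: virtual_link_diagram_def run_append split: bind_splits)
    then show ?thesis by (rule local_move_coloring[OF 1(3)])
  qed
  then show ?thesis unfolding 1(1,2) coloring_append by metis
qed

lemma virtual_link_coloring:
  assumes "D' \<in> virtual_link D"
  shows "coloring D [] [] z \<longleftrightarrow> coloring D' [] [] z"
proof -
  have "equivclp diagram_move D D'" using assms by (simp add: virtual_link_def)
  then show ?thesis
    by (induction rule: equivclp_induct) (use diagram_move_coloring in blast)+
qed


section \<open>Checkerboard colourings and the closures\<close>

lemma slice_outside:
  assumes "slice (e, p) w = Some w'"
  shows "take p w' = take p w" "drop (p + outs e) w' = drop (p + ins e) w"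
  using assms by (cases e; auto split: if_splits)+

lemma run_level:
  assumes "virtual_link_diagram D" "n \<le> length D"
  shows "run (take n D) [] = Some (level D n)"
proof -
  have "run (take n D @ drop n D) [] = Some []"
    using assms(1) by (simp add: virtual_link_diagram_def)
  then show ?thesis by (auto simp only: run_append level_def split: bind_splits) auto
qed

lemma slice_level:
  assumes "virtual_link_diagram D" "n < length D"
  shows "slice (D ! n) (level D n) = Some (level D (Suc n))"
proof -
  have "run (take n D @ [D ! n]) [] = Some (level D (Suc n))"
    using run_level[OF assms(1), of "Suc n"] assms(2) by (simp add: take_Suc_conv_app_nth)
  then show ?thesis
    using run_level[OF assms(1), of n] assms(2) by (auto simp: run_append split: bind_splits)
qed

lemma checkerboard_coloring:
  assumes D: "virtual_link_diagram D" and "checkerboard_colorable_diagram D"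
  shows "coloring D [] [] 0"
proof -
  obtain color :: "half_band set \<Rightarrow> bool" where color:
    "\<And>n i. n \<le> length D \<Longrightarrow> i < length (level D n) \<Longrightarrow>
      color (region D (n, i, West)) \<noteq> color (region D (n, i, East))"
    using assms(2) by (auto simp: checkerboard_colorable_diagram_def)
  define c where "c h = color (region D h)" for h
  \<comment> \<open>Adjacent half bands lie in the same region, so their colours agree.\<close>
  have adj: "c h = c h'" if "adjacent D h h'" for h h'
  proof -
    have "equivclp (adjacent D) h h'" using that by blast
    then have "region D h = region D h'"
      by (auto simp: region_def intro: equivclp_trans equivclp_sym)
    then show ?thesis by (simp add: c_def)
  qed
  have east: "c (n, i, East) = (\<not> c (n, i, West))"
    if "n \<le> length D" "i < length (level D n)" for n i
    using color[OF that] by (auto simp: c_def)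
  \<comment> \<open>The coloured states: each strand point takes as its bit the colour of the west
    half of its band.\<close>
  define w where "w n = map (\<lambda>i. (level D n ! i, c (n, i, West))) [0..<length (level D n)]" for n
  have step: "slice_coloring (D ! n) (w n) (w (Suc n)) 0" if n: "n < length D" for n
  proof -
    obtain e p where e: "D ! n = (e, p)" by (cases "D ! n")
    have s: "slice (e, p) (level D n) = Some (level D (Suc n))"
      using slice_level[OF D n] e by simp
    have le: "p + ins e \<le> length (level D n)" using s by (intro slice_bound) auto
    have len: "length (level D (Suc n)) + ins e = length (level D n) + outs e"
      using slice_length[OF s] .
    have left: "take p (w (Suc n)) = take p (w n)"
    proof (rule nth_equalityI)
      fix i assume "i < length (take p (w (Suc n)))"
      then have i: "i < p" by simp
      then show "take p (w (Suc n)) ! i = take p (w n) ! i"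
        using arg_cong[OF slice_outside(1)[OF s], of "\<lambda>l. l ! i"] le len
          adj[OF adjacent.pass_left[OF n e i]] by (simp add: w_def)
    qed (use le len in \<open>simp add: w_def\<close>)
    have right: "drop (p + outs e) (w (Suc n)) = drop (p + ins e) (w n)"
    proof (rule nth_equalityI)
      fix m assume "m < length (drop (p + outs e) (w (Suc n)))"
      then have m: "p + ins e + m < length (level D n)" using len by (simp add: w_def)
      then show "drop (p + outs e) (w (Suc n)) ! m = drop (p + ins e) (w n) ! m"
        using arg_cong[OF slice_outside(2)[OF s], of "\<lambda>l. l ! m"] le len
          adj[OF adjacent.pass_right[OF n e m]] by (simp add: w_def)
    qed (use le len in \<open>simp add: w_def\<close>)
    have two: "take 2 (drop p (w k)) = [w k ! p, w k ! Suc p]"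
      if "Suc p < length (level D k)" for k
      using that by (intro nth_equalityI) (auto simp: w_def less_2_cases_iff nth_append)
    have mid: "event_coloring e (take (ins e) (drop p (w n))) (take (outs e) (drop p (w (Suc n)))) 0"
    proof (cases e)
      case (Cap d)
      then have "level D (Suc n) = take p (level D n) @ d # opp d # drop p (level D n)"
        using s by (simp split: if_splits)
      then have l: "level D (Suc n) ! p = d" "level D (Suc n) ! Suc p = opp d"
        using le by (simp_all add: nth_append)
      \<comment> \<open>Under the maximum the east half of the left leg meets the west half of the
        right leg, so the west colours of the legs differ, as \<open>turn\<close> demands.\<close>
      show ?thesis
        using Cap two[of "Suc n"] le len l e n adj[OF adjacent.cap_inner[of n D d p]]
          east[of "Suc n" p]
        by (auto simp: w_def turn_def)
    next
      case Cup
      then have l: "level D n ! Suc p = opp (level D n ! p)"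
        using s by (auto split: if_splits)
      show ?thesis
        using Cup two[of n] le len l e n adj[OF adjacent.cup_inner[of n D p]] east[of n p]
        by (auto simp: w_def turn_def)
    next
      case (Cross t)
      then have "level D (Suc n) = (level D n)[p := level D n ! Suc p, Suc p := level D n ! p]"
        using s by (simp split: if_splits)
      then have l: "level D (Suc n) ! p = level D n ! Suc p"
          "level D (Suc n) ! Suc p = level D n ! p"
        using le Cross by simp_all
      show ?thesis
      proof (cases "t = Virtual")
        case True
        show ?thesis
          using Cross True two[of n] two[of "Suc n"] le len l e n
            adj[OF adjacent.virtual_NW_SE[of n D p West]]
            adj[OF adjacent.virtual_NE_SW[of n D p West]]
          by (auto simp: w_def pass_def weight_def)
      next
        case False
        \<comment> \<open>The north corner gives the incoming strands different bits, so the weight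
          is 0. The west and south corners show that each outgoing bit is the flipped bit of its
          strand.\<close>
        show ?thesis
          using Cross False two[of n] two[of "Suc n"] le len l e n
            adj[OF adjacent.corner_north[of n D t p]] adj[OF adjacent.corner_south[of n D t p]]
            adj[OF adjacent.corner_west[of n D t p]] east[of n p] east[of "Suc n" p]
          by (auto simp: w_def pass_def weight_def)
      qed
    qed
    have "w k = take p (w k) @ take j (drop p (w k)) @ drop (p + j) (w k)" for k j
      by (metis append_take_drop_id drop_drop add.commute)
    from this[of n "ins e"] this[of "Suc n" "outs e"] show ?thesis
      unfolding e slice_coloring.simps using left right mid le
      by (intro exI[of _ "take p (w n)"] exI[of _ "take (ins e) (drop p (w n))"]
          exI[of _ "take (outs e) (drop p (w (Suc n)))"] exI[of _ "drop (p + ins e) (w n)"])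
        (auto simp: w_def)
  qed
  have "coloring (take n D) [] (w n) 0" if "n \<le> length D" for n
    using that
  proof (induction n)
    case 0
    show ?case by (simp add: w_def level_def)
  next
    case (Suc n)
    then have "coloring (take n D) [] (w n) 0" "coloring [D ! n] (w n) (w (Suc n)) 0"
      using step[of n] by (simp_all add: coloring.simps(2))
    then have "coloring (take n D @ [D ! n]) [] (w (Suc n)) (0 + 0)"
      unfolding coloring_append by blast
    then show ?case
      using Suc.prems by (simp add: take_Suc_conv_app_nth)
  qed
  from this[of "length D"] have "coloring D [] (w (length D)) 0" by simp
  moreover have "w (length D) = []"
    using D by (simp add: w_def level_def virtual_link_diagram_def)
  ultimately show ?thesis by simp
qed

section \<open>Colourings of the closed 2-braids\<close>

text \<open>One crossing exchanges and flips the bits, and two crossings restore them. Agreement of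
  the bits is preserved throughout, so either all \<open>n\<close> crossings count, with the same
  sign, or none does.\<close>

lemma coloring_sigma_power:
  assumes "t \<noteq> Virtual"
  shows "coloring (replicate n (Cross t, 0) @ D) ((d, a) # (d, b) # v) w z \<longleftrightarrow>
    coloring D (if even n then (d, a) # (d, b) # v else (d, \<not> b) # (d, \<not> a) # v) w
      (z - (if a = b then int n * parallel_sign t else 0))"
proof (induction n arbitrary: a b z)
  case (Suc n)
  show ?case
    using coloring_cross[of "[]" 0] Suc.IH assms
    by (auto simp: pass_def weight_def algebra_simps)
qed simp

lemma not_coloring_VT2:
  assumes "k \<noteq> 0"
  shows "\<not> coloring (braid_closure 2 (sigma_power 1 k @ [Vi 1])) [] [] 0"
proof
  assume *: "coloring (braid_closure 2 (sigma_power 1 k @ [Vi 1])) [] [] 0"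
  define t where "t = (if k \<ge> 0 then Over_NE else Over_NW)"
  define n where "n = nat \<bar>k\<bar>"
  have n: "n \<noteq> 0" using assms by (simp add: n_def)
  have t: "t \<noteq> Virtual" "parallel_sign t \<noteq> 0" by (simp_all add: t_def)
  have "[0..<2] = [0, 1::nat]" by (simp add: upt_rec)
  then have "braid_closure 2 (sigma_power 1 k @ [Vi 1]) =
      (Cap Down, 0) # (Cap Down, 1) # replicate n (Cross t, 0) @
      [(Cross Virtual, 0), (Cup, 1), (Cup, 0)]"
    by (simp add: braid_closure_def sigma_power_def t_def n_def map_replicate)
  \<comment> \<open>The bits \<open>a\<close> and \<open>b\<close> are the free choices at the two
    nested maxima; the turned strands are the closing arcs.\<close>
  with * obtain a b where
    "coloring (replicate n (Cross t, 0) @ [(Cross Virtual, 0), (Cup, 1), (Cup, 0)])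
      [(Down, a), (Down, b), turn (Down, b), turn (Down, a)] [] 0"
    using coloring_cap[of "[]" 0 Down] coloring_cap[of "[x]" 1 Down for x]
    by (auto simp: split_paired_Ex)
  then have *: "coloring [(Cross Virtual, 0), (Cup, 1), (Cup, 0)]
      ((if even n then [(Down, a), (Down, b)] else [(Down, \<not> b), (Down, \<not> a)]) @
        [turn (Down, b), turn (Down, a)]) [] (if a = b then - (int n * parallel_sign t) else 0)"
    by (simp only: coloring_sigma_power[OF t(1)]) (simp split: if_splits)
  \<comment> \<open>The virtual crossing exchanges the strands without changing them, so the minima
    join \<open>x\<close> to the arc of \<open>y'\<close> and \<open>y\<close> to the arc of
    \<open>x'\<close>.\<close>
  have end_iff: "coloring [(Cross Virtual, 0), (Cup, 1), (Cup, 0)] [x, y, turn y', turn x'] [] z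
      \<longleftrightarrow> y = x' \<and> x = y' \<and> z = 0" for x y x' y' z
    using coloring_cross[of "[]" 0] coloring_cup[of "[]" 0 "[]"] coloring_cup[of "[y]" 1]
    by (auto simp: turn_eq_iff(1))
  show False
    \<comment> \<open>For odd \<open>n\<close> each strand closes up with itself and its bit would
      equal its own negation. For even \<open>n\<close> closing forces \<open>a = b\<close>, and
      then the twists contribute \<open>int n * parallel_sign t\<close>, which is not 0.\<close>
    using * t(2) n by (cases "even n"; cases a; cases b) (simp_all add: end_iff[simplified])
qed

theorem proposition4p6:
  fixes k :: int
  assumes "k \<noteq> 0"
  shows "\<not> checkerboard_colorable (VT2 k)"
proof
  assume "checkerboard_colorable (VT2 k)"
  then obtain D where D: "D \<in> VT2 k" "checkerboard_colorable_diagram D"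
    by (auto simp: checkerboard_colorable_def)
  then have "coloring D [] [] 0"
    by (intro checkerboard_coloring) (auto simp: VT2_def virtual_link_def)
  then show False
    using virtual_link_coloring D(1) not_coloring_VT2[OF assms] unfolding VT2_def by blast
qed

end
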